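(* Let $A \in \mathcal{M}_n^{+}$ be an entrywise non-negative positive semidefinite matrix. If every principal $2 \times 2$ submatrix of $A$ is positive definite, then there exists a natural number $M$ such that $A^{\odot m}$ has factor width at most $2$ whenever $m \geq M$ is a natural number.
   Context: $\mathcal{M}_n^{+}$ denotes the set of $n \times n$ positive semidefinite (symmetric) matrices. $A^{\odot m}$ is the $m$-th Hadamard (entrywise) power, with $(i,j)$-entry $a_{i,j}^m$. The factor width of a positive semidefinite matrix $A$ is the smallest positive integer $k$ such that $A = \sum_{j=1}^r \mathbf{v}_j\mathbf{v}_j^*$ for some $r$ and some vectors $\mathbf{v}_1,\ldots,\mathbf{v}_r$, each with at most $k$ non-zero entries (for real $A$ the value is the same whether the vectors are taken in $\mathbb{R}^n$ or $\mathbb{C}^n$). *)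

theory Defs
  imports "HOL-Analysis.Analysis" "HOL-Library.Extended_Nat"
begin

definition positive_semidefinite :: "real^'n^'n \<Rightarrow> bool" where
  "positive_semidefinite A \<longleftrightarrow> transpose A = A \<and> (\<forall>x. 0 \<le> x \<bullet> (A *v x))"

definition positive_definite :: "real^'n^'n \<Rightarrow> bool" where
  "positive_definite A \<longleftrightarrow> transpose A = A \<and> (\<forall>x. x \<noteq> 0 \<longrightarrow> 0 < x \<bullet> (A *v x))"

text \<open>For an injective \<open>f\<close> this is the principal submatrix on the rows and columns in the
  range of \<open>f\<close>, listed in the order given by \<open>f\<close>.\<close>

definition principal_submatrix :: "'a^'n^'n \<Rightarrow> ('k \<Rightarrow> 'n) \<Rightarrow> 'a^'k^'k" where
  "principal_submatrix A f = (\<chi> i j. A $ f i $ f j)"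

definition hadamard_power :: "real^'n^'n \<Rightarrow> nat \<Rightarrow> real^'n^'n" where
  "hadamard_power A m = (\<chi> i j. (A $ i $ j) ^ m)"

definition outer_square :: "real^'n \<Rightarrow> real^'n^'n" where
  "outer_square v = (\<chi> i j. v $ i * v $ j)"

text \<open>The vectors are real: for a real matrix, splitting complex \<open>v\<close> into real and imaginary parts
  gives the same value. The infimum is a minimum whenever some admissible \<open>k\<close> exists, in particular for every
  positive semidefinite \<open>A\<close>; it is \<open>\<infinity>\<close> exactly when there is no decomposition at all,
  so a finite bound on \<open>factor_width A\<close> always provides a decomposition.\<close>

definition factor_width :: "real^'n^'n \<Rightarrow> enat" where
  "factor_width A = Inf {enat k | k. 0 < k \<and>
     (\<exists>(r::nat) (v :: nat \<Rightarrow> real^'n).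
        (\<forall>j<r. card {i. v j $ i \<noteq> 0} \<le> k) \<and> A = (\<Sum>j<r. outer_square (v j)))}"

end

theory Submission
  imports Defs
begin

text \<open>
  Let \<open>n \<ge> 2\<close>, so that all \<open>d\<^sub>i = \<surd>a\<^sub>i\<^sub>i\<close> are positive. Positive
  definiteness of the \<open>2 \<times> 2\<close> principal submatrices says that
  \<open>0 \<le> a\<^sub>i\<^sub>j / (d\<^sub>i d\<^sub>j) < 1\<close> off the diagonal, so the Hadamard powers of the matrix of these
  quotients, whose diagonal consists of ones, converge to the identity. From some exponent on,
  that matrix is therefore diagonally dominant; equivalently, the power of \<open>A\<close> is diagonally
  dominant after the diagonal scaling by \<open>d\<^sub>i\<^sup>-\<^sup>m\<close>.

  A symmetric non-negative matrix that is diagonally dominant up to a positive scaling has factor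
  width at most two (\<open>factor_width_scaled_diagonally_dominant\<close>): each pair of equal off-diagonal
  entries is produced by a rank-one matrix living on two coordinates, and dominance says exactly
  that what these matrices contribute to the diagonal does not exceed the available diagonal
  entries, so that the remainder is a non-negative diagonal matrix.
\<close>

lemma factor_width_le:
  fixes w :: "'a \<Rightarrow> real^'n"
  assumes "finite I" and "0 < k"
    and supp: "\<And>t. t \<in> I \<Longrightarrow> card {i. w t $ i \<noteq> 0} \<le> k"
    and sum: "A = (\<Sum>t\<in>I. outer_square (w t))"
  shows "factor_width A \<le> enat k"
proof -
  obtain e where e: "bij_betw e {..<card I} I"
    using \<open>finite I\<close> bij_betw_from_nat_into_finite by blast
  have "\<forall>j<card I. card {i. w (e j) $ i \<noteq> 0} \<le> k"
    using e supp by (auto dest: bij_betwE)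
  moreover have "A = (\<Sum>j<card I. outer_square (w (e j)))"
    unfolding sum by (rule sum.reindex_bij_betw[OF e, symmetric])
  ultimately have "\<exists>(r::nat) v. (\<forall>j<r. card {i. v j $ i \<noteq> 0} \<le> k) \<and>
      A = (\<Sum>j<r. outer_square (v j))"
    by (intro exI[where x = "card I"] exI[where x = "\<lambda>j. w (e j)"] conjI)
  then show ?thesis
    unfolding factor_width_def using \<open>0 < k\<close> by (intro Inf_lower) blast
qed

text \<open>
  For \<open>i \<noteq> j\<close> the rank-one matrix of \<open>\<surd>h\<^sub>i\<^sub>j (\<surd>(u\<^sub>j/u\<^sub>i) e\<^sub>i + \<surd>(u\<^sub>i/u\<^sub>j) e\<^sub>j)\<close> has the
  off-diagonal entry \<open>h\<^sub>i\<^sub>j\<close> and the diagonal entries \<open>h\<^sub>i\<^sub>j u\<^sub>j/u\<^sub>i\<close> and \<open>h\<^sub>i\<^sub>j u\<^sub>i/u\<^sub>j\<close>. Summed over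
  all unordered pairs, the \<open>i\<close>-th diagonal entry is \<open>(\<Sum>j\<noteq>i. h\<^sub>i\<^sub>j u\<^sub>j) / u\<^sub>i\<close>, which dominance bounds by
  \<open>h\<^sub>i\<^sub>i\<close>.
\<close>

lemma factor_width_scaled_diagonally_dominant:
  fixes H :: "real^'n^'n" and u :: "'n \<Rightarrow> real"
  assumes sym: "\<And>i j. H $ i $ j = H $ j $ i"
    and nonneg: "\<And>i j. 0 \<le> H $ i $ j"
    and pos: "\<And>i. 0 < u i"
    and dom: "\<And>i. (\<Sum>j\<in>UNIV - {i}. H $ i $ j * u j) \<le> H $ i $ i * u i"
  shows "factor_width H \<le> 2"
proof -
  define g where "g i j = (if i = j then 0 else H $ i $ j)" for i j
  define c where "c i = H $ i $ i - (\<Sum>j\<in>UNIV. g i j * (u j / u i))" for i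
  \<comment> \<open>Pairs are ordered, so that each unordered pair occurs twice, whence the factor \<open>1/2\<close>.\<close>
  define w :: "'n \<times> 'n \<Rightarrow> real^'n" where
    "w = (\<lambda>(i, j). if i = j then sqrt (c i) *\<^sub>R axis i 1
       else sqrt (g i j / 2 * (u j / u i)) *\<^sub>R axis i 1 + sqrt (g i j / 2 * (u i / u j)) *\<^sub>R axis j 1)"
  have g_sym: "g i j = g j i" and g_nonneg: "0 \<le> g i j" and g_diag: "g i i = 0" for i j
    using sym nonneg by (auto simp: g_def)
  have c_nonneg: "0 \<le> c i" for i
  proof -
    have "(\<Sum>j\<in>UNIV. g i j * u j) = (\<Sum>j\<in>UNIV - {i}. H $ i $ j * u j)"
      by (rule sum.mono_neutral_cong_right) (auto simp: g_def)
    then have "(\<Sum>j\<in>UNIV. g i j * u j) / u i \<le> H $ i $ i"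
      using dom[of i] pos[of i] by (simp add: pos_divide_le_eq)
    then show ?thesis
      by (simp add: c_def sum_divide_distrib)
  qed
  have supp: "card {k. w t $ k \<noteq> 0} \<le> 2" for t
  proof -
    obtain i j where t: "t = (i, j)"
      by force
    have "{k. w t $ k \<noteq> 0} \<subseteq> {i, j}"
      by (auto simp: t w_def axis_def split: if_splits)
    then have "card {k. w t $ k \<noteq> 0} \<le> card {i, j}"
      by (intro card_mono) auto
    also have "\<dots> \<le> 2"
      by (simp add: card_insert_if)
    finally show ?thesis .
  qed
  \<comment> \<open>The nested conditionals put the tests in a form in which summing over \<open>j\<close> and then over \<open>i\<close>
     picks out one index at a time.\<close>
  have entry: "outer_square (w (i, j)) $ p $ q =
      (if i = p then if j = p \<and> p = q then c p else 0 else 0)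
      + (if i = p then if p = q then g p j / 2 * (u j / u p) else 0 else 0)
      + (if j = p then if p = q then g i p / 2 * (u i / u p) else 0 else 0)
      + (if i = p then if j = q then g p q / 2 else 0 else 0)
      + (if i = q then if j = p then g q p / 2 else 0 else 0)" for i j p q
  proof (cases "i = j")
    case True
    then show ?thesis
      using c_nonneg[of j] by (auto simp: outer_square_def w_def axis_def g_diag)
  next
    case False
    define x where "x = sqrt (g i j / 2 * (u j / u i))"
    define y where "y = sqrt (g i j / 2 * (u i / u j))"
    have xx: "x * x = g i j / 2 * (u j / u i)" and yy: "y * y = g i j / 2 * (u i / u j)"
      unfolding x_def y_def
      by (simp_all only: real_sqrt_mult_self abs_of_nonneg)
        (use g_nonneg[of i j] pos[of i] pos[of j] in auto)
    have "(g i j / 2 * (u j / u i)) * (g i j / 2 * (u i / u j)) = (g i j / 2)\<^sup>2"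
      using pos[of i] pos[of j] by (simp add: power2_eq_square)
    then have xy: "x * y = g i j / 2"
      unfolding x_def y_def using g_nonneg[of i j] by (simp flip: real_sqrt_mult)
    have "w (i, j) $ k = (if k = i then x else if k = j then y else 0)" for k
      using False by (simp add: w_def x_def y_def axis_def)
    then have product: "outer_square (w (i, j)) $ p $ q =
        (if p = i then x else if p = j then y else 0) * (if q = i then x else if q = j then y else 0)"
      by (simp add: outer_square_def)
    consider "p = i" "q = i" | "p = i" "q = j" | "p = j" "q = i" | "p = j" "q = j"
      | "p \<noteq> i" "p \<noteq> j" | "q \<noteq> i" "q \<noteq> j"
      by blast
    then show ?thesis
      unfolding product using False by cases (auto simp: xx yy xy mult.commute[of y x])
  qed
  have "H = (\<Sum>t\<in>UNIV. outer_square (w t))"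
  proof -
    have "(\<Sum>t\<in>UNIV. outer_square (w t)) $ p $ q = H $ p $ q" for p q
    proof -
      have pull: "(\<Sum>j\<in>UNIV. if b then f j else 0) = (if b then \<Sum>j\<in>UNIV. f j else 0)"
        for b and f :: "'n \<Rightarrow> real"
        by simp
      have "(\<Sum>t\<in>UNIV. outer_square (w t)) $ p $ q
          = (\<Sum>i\<in>UNIV. \<Sum>j\<in>UNIV. outer_square (w (i, j)) $ p $ q)"
        by (simp add: sum.cartesian_product flip: UNIV_Times_UNIV)
      also have "\<dots> = (if p = q then c p else 0)
          + (if p = q then \<Sum>j\<in>UNIV. g p j / 2 * (u j / u p) else 0)
          + (if p = q then \<Sum>i\<in>UNIV. g i p / 2 * (u i / u p) else 0)
          + g p q / 2 + g q p / 2"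
        unfolding entry sum.distrib pull by (auto simp: pull)
      also have "\<dots> = H $ p $ q"
      proof (cases "p = q")
        case True
        have "(\<Sum>i\<in>UNIV. g i p / 2 * (u i / u p)) = (\<Sum>i\<in>UNIV. g p i * (u i / u p)) / 2"
          and "(\<Sum>i\<in>UNIV. g p i / 2 * (u i / u p)) = (\<Sum>i\<in>UNIV. g p i * (u i / u p)) / 2"
          by (simp_all add: sum_divide_distrib g_sym[of _ p] mult.commute)
        with True show ?thesis
          by (simp add: c_def g_diag)
      next
        case False
        then show ?thesis
          using g_sym[of p q] by (simp add: g_def)
      qed
      finally show ?thesis .
    qed
    then show ?thesis
      by (simp add: vec_eq_iff)
  qed
  then have "factor_width H \<le> enat 2"
    by (intro factor_width_le[of UNIV 2 w]) (use supp in auto)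
  then show ?thesis
    by (simp add: numeral_eq_enat)
qed

lemma positive_definite_2:
  fixes B :: "real^2^2"
  assumes "positive_definite B"
  shows "0 < B $ 1 $ 1" and "(B $ 1 $ 2)\<^sup>2 < B $ 1 $ 1 * B $ 2 $ 2"
proof -
  have "transpose B $ 1 $ 2 = B $ 1 $ 2"
    using assms by (simp add: positive_definite_def)
  then have sym: "B $ 2 $ 1 = B $ 1 $ 2"
    by (simp add: transpose_def)
  have form: "0 < a * (B $ 1 $ 1 * a + B $ 1 $ 2 * b) + b * (B $ 1 $ 2 * a + B $ 2 $ 2 * b)"
    if "a \<noteq> 0 \<or> b \<noteq> 0" for a b
  proof -
    have "(vector [a, b] :: real^2) \<noteq> 0"
      using that by (auto simp: vec_eq_iff forall_2)
    then have "0 < (vector [a, b] :: real^2) \<bullet> (B *v vector [a, b])"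
      using assms by (auto simp: positive_definite_def)
    then show ?thesis
      by (simp add: inner_vec_def matrix_vector_mult_def sum_2 sym)
  qed
  show pos: "0 < B $ 1 $ 1"
    using form[of 1 0] by simp
  \<comment> \<open>\<open>B\<close> maps the vector \<open>(-B\<^sub>1\<^sub>2, B\<^sub>1\<^sub>1)\<close>, orthogonal to its first row, to \<open>(0, det B)\<close>.\<close>
  have "0 < B $ 1 $ 1 * (B $ 1 $ 1 * B $ 2 $ 2 - (B $ 1 $ 2)\<^sup>2)"
    using form[of "- B $ 1 $ 2" "B $ 1 $ 1"] pos by (simp add: algebra_simps power2_eq_square)
  with pos show "(B $ 1 $ 2)\<^sup>2 < B $ 1 $ 1 * B $ 2 $ 2"
    by (simp add: zero_less_mult_iff)
qed

lemma principal_minors_2_pos: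
  fixes A :: "real^'n^'n"
  assumes "\<forall>f :: 2 \<Rightarrow> 'n. inj f \<longrightarrow> positive_definite (principal_submatrix A f)"
    and "i \<noteq> j"
  shows "0 < A $ i $ i" and "(A $ i $ j)\<^sup>2 < A $ i $ i * A $ j $ j"
proof -
  define f :: "2 \<Rightarrow> 'n" where "f k = (if k = 1 then i else j)" for k
  have "inj f"
    unfolding inj_def forall_2 using \<open>i \<noteq> j\<close> by (simp add: f_def)
  then have "positive_definite (principal_submatrix A f)"
    using assms(1) by blast
  from positive_definite_2[OF this]
  show "0 < A $ i $ i" and "(A $ i $ j)\<^sup>2 < A $ i $ i * A $ j $ j"
    by (simp_all add: principal_submatrix_def f_def)
qed

lemma eventually_mult_power_le:
  fixes a b c :: real
  assumes "0 \<le> a" and "a < b"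
  shows "eventually (\<lambda>m. c * a ^ m \<le> b ^ m) sequentially"
proof -
  have "(\<lambda>m. c * (a / b) ^ m) \<longlonglongrightarrow> c * 0"
    using assms by (intro tendsto_mult_left LIMSEQ_realpow_zero) auto
  then have "eventually (\<lambda>m. c * (a / b) ^ m < 1) sequentially"
    by (simp add: order_tendstoD(2))
  then show ?thesis
    by eventually_elim (use assms in \<open>simp add: power_divide divide_simps\<close>)
qed

theorem theorem10:
  fixes A :: "real^'n^'n"
  assumes "positive_semidefinite A"
    and "\<forall>i j. 0 \<le> A $ i $ j"
    and "\<forall>f :: 2 \<Rightarrow> 'n. inj f \<longrightarrow> positive_definite (principal_submatrix A f)"
  shows "\<exists>M::nat. \<forall>m\<ge>M. factor_width (hadamard_power A m) \<le> 2"
proof -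
  have sym: "A $ i $ j = A $ j $ i" for i j
  proof -
    have "transpose A $ i $ j = A $ i $ j"
      using assms(1) by (simp add: positive_semidefinite_def)
    then show ?thesis
      by (simp add: transpose_def)
  qed
  have nonneg: "0 \<le> A $ i $ j" for i j
    using assms(2) by blast
  \<comment> \<open>If \<open>A\<close> is \<open>1 \<times> 1\<close>, its only entry may vanish; any positive weight then serves.\<close>
  define d where "d i = (if A $ i $ i = 0 then 1 else sqrt (A $ i $ i))" for i
  have d_pos: "0 < d i" for i
    using nonneg[of i i] by (simp add: d_def)
  have "A $ i $ j < d i * d j" if "i \<noteq> j" for i j
  proof -
    have "0 < A $ i $ i" "0 < A $ j $ j" and det: "(A $ i $ j)\<^sup>2 < A $ i $ i * A $ j $ j"
      using principal_minors_2_pos[OF assms(3)] that that[symmetric] by blast+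
    then have "d i * d j = sqrt (A $ i $ i * A $ j $ j)"
      by (simp add: d_def real_sqrt_mult)
    then show ?thesis
      using det by (simp add: real_less_rsqrt)
  qed
  \<comment> \<open>A row has fewer than \<open>n\<close> off-diagonal entries, so a factor \<open>n\<close> makes their sum dominated.\<close>
  then have "\<forall>\<^sub>F m in sequentially. \<forall>i j. i \<noteq> j \<longrightarrow>
      real CARD('n) * (A $ i $ j) ^ m \<le> (d i * d j) ^ m"
    using nonneg by (intro eventually_all_finite)
      (auto intro: eventually_mult_power_le simp: eventually_all_finite)
  then obtain M where M: "\<And>m i j. m \<ge> M \<Longrightarrow> i \<noteq> j \<Longrightarrow>
      real CARD('n) * (A $ i $ j) ^ m \<le> (d i * d j) ^ m"
    unfolding eventually_sequentially by blast
  have "factor_width (hadamard_power A m) \<le> 2" if "m \<ge> M" for m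
  proof (rule factor_width_scaled_diagonally_dominant[where u = "\<lambda>i. 1 / d i ^ m"])
    fix i
    show "(\<Sum>j\<in>UNIV - {i}. hadamard_power A m $ i $ j * (1 / d j ^ m))
        \<le> hadamard_power A m $ i $ i * (1 / d i ^ m)"
    proof (cases "UNIV = {i}")
      case True
      then show ?thesis
        using nonneg[of i i] d_pos[of i] by (simp add: hadamard_power_def)
    next
      case False
      then obtain k where "i \<noteq> k"
        by (metis UNIV_eq_I singleton_iff)
      then have "0 < A $ i $ i"
        using principal_minors_2_pos(1)[OF assms(3)] by blast
      then have diag: "(A $ i $ i) ^ m = d i ^ m * d i ^ m"
        by (simp add: d_def flip: power_mult_distrib)
      have "(\<Sum>j\<in>UNIV - {i}. (A $ i $ j) ^ m / d j ^ m)
          \<le> (\<Sum>j\<in>UNIV - {i}. d i ^ m / real CARD('n))"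
      proof (rule sum_mono)
        fix j assume "j \<in> UNIV - {i}"
        then show "(A $ i $ j) ^ m / d j ^ m \<le> d i ^ m / real CARD('n)"
          using M[OF that, of i j] d_pos[of j]
          by (simp add: divide_simps power_mult_distrib mult.commute)
      qed
      also have "\<dots> \<le> (\<Sum>j\<in>(UNIV :: 'n set). d i ^ m / real CARD('n))"
        by (intro sum_mono2) (use d_pos[of i] in \<open>auto simp: less_imp_le\<close>)
      also have "\<dots> = d i ^ m"
        by simp
      finally show ?thesis
        using diag d_pos[of i] by (simp add: hadamard_power_def)
    qed
  qed (use nonneg d_pos sym in \<open>auto simp: hadamard_power_def\<close>)
  then show ?thesis
    by blast
qed

end
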